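(* There exist constants $c>0$ and $n_0$ such that for all integers $n\geqslant n_0$ and all integers $k$ with $0\leqslant k<n$, $$\delta_C(n,k) \geqslant c\,\frac{n}{(k+1)\log n}.$$ (That is, $\delta_C(n,k)=\Omega\big(n/((k+1)\log n)\big)$.)
   Context: For a graph $G$ whose vertices are points in the plane, each edge $(u,v)$ has weight equal to the Euclidean distance $d(u,v)$ (edges may cross or overlap), and $d_G(u,v)$ is the length of a shortest path in $G$ between $u$ and $v$. The dilation of $G$ is $\Delta(G)=\max_{u\neq v\in V(G)} d_G(u,v)/d(u,v)$ (infinite if $G$ is disconnected). For a finite set $S$ of $n$ points and an integer $k\ge0$, $\Delta(S,k)$ is the minimum of $\Delta(G)$ over all graphs $G$ with vertex set exactly $S$ and exactly $n-1+k$ edges. $\delta_C(n,k)$ is the supremum of $\Delta(S,k)$ over all sets $S$ of $n$ points in $\mathbb{R}^2$ in convex position (all points lie on the boundary of their convex hull). *)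

theory Defs
  imports "HOL-Analysis.Analysis" "HOL-Library.Extended_Real"
begin

type_synonym point = "real ^ 2"

definition geom_graph :: "point set \<Rightarrow> point set set \<Rightarrow> bool" where
  "geom_graph V E \<longleftrightarrow> (\<forall>e\<in>E. \<exists>u v. u \<in> V \<and> v \<in> V \<and> u \<noteq> v \<and> e = {u, v})"

definition is_walk :: "point set set \<Rightarrow> point list \<Rightarrow> point \<Rightarrow> point \<Rightarrow> bool" where
  "is_walk E p u v \<longleftrightarrow> p \<noteq> [] \<and> hd p = u \<and> last p = v \<and>
     (\<forall>i < length p - 1. {p ! i, p ! Suc i} \<in> E)"

definition walk_length :: "point list \<Rightarrow> real" where
  "walk_length p = (\<Sum>i < length p - 1. dist (p ! i) (p ! Suc i))"

(* shortest-path distance d_G(u,v); infinite if no path *)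
definition graph_dist :: "point set set \<Rightarrow> point \<Rightarrow> point \<Rightarrow> ereal" where
  "graph_dist E u v = (INF p \<in> {p. is_walk E p u v}. ereal (walk_length p))"

definition dilation :: "point set \<Rightarrow> point set set \<Rightarrow> ereal" where
  "dilation V E = (SUP uv \<in> {(u, v). u \<in> V \<and> v \<in> V \<and> u \<noteq> v}.
                     graph_dist E (fst uv) (snd uv) / ereal (dist (fst uv) (snd uv)))"

definition min_dilation :: "point set \<Rightarrow> nat \<Rightarrow> ereal" where
  "min_dilation S k = (INF E \<in> {E. geom_graph S E \<and> card E = card S - 1 + k}. dilation S E)"

definition convex_position :: "point set \<Rightarrow> bool" where
  "convex_position S \<longleftrightarrow> S \<subseteq> frontier (convex hull S)"

definition delta_C :: "nat \<Rightarrow> nat \<Rightarrow> ereal" where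
  "delta_C n k = (SUP S \<in> {S. finite S \<and> card S = n \<and> convex_position S}. min_dilation S k)"

end

theory Submission
  imports Defs
begin

text \<open>
  Place all points on the two lines at heights \<open>0\<close> and \<open>1\<close>. The set contains \<open>k + 1\<close> gadgets; a gadget
  with centre \<open>c\<close> consists of the points at abscissae \<open>c \<plusminus> ((1 + \<epsilon>)^i - 1)\<close>, \<open>i \<le> N\<close>, on both lines.
  Suppose the dilation is less than \<open>D\<close>, where \<open>D * \<epsilon> \<le> 1/2\<close> and \<open>D \<le> X = (1 + \<epsilon>)^N - 1\<close>. The short walk
  between horizontally neighbouring gadget points either stays on its line (near the centre) or stays on
  its side of the centre (further out), and the short walk between the two extreme points at
  \<open>c + X\<close> (or at \<open>c - X\<close>) stays on its side. Following these walks around the gadget gives a closed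
  walk that crosses the abscissa \<open>c\<close> on the upper line once in net, so the gadget is not a forest. Hence
  one edge per gadget can be deleted without disconnecting the graph, which therefore has at least \<open>n + k\<close>
  edges. Only \<open>N\<close> of order \<open>D log n\<close> points are needed per gadget, so \<open>D\<close> can be of order
  \<open>n / ((k + 1) log n)\<close>.
\<close>

subsection \<open>Edge sets, connectivity and cycles\<close>

definition edge_rel :: "'a set set \<Rightarrow> ('a \<times> 'a) set" where
  "edge_rel E = {(u, v). {u, v} \<in> E}"

lemma edge_rel_iff [simp]: "(u, v) \<in> edge_rel E \<longleftrightarrow> {u, v} \<in> E"
  by (simp add: edge_rel_def)

lemma edge_rel_rtrancl_mono: "E \<subseteq> F \<Longrightarrow> (u, v) \<in> (edge_rel E)\<^sup>* \<Longrightarrow> (u, v) \<in> (edge_rel F)\<^sup>*"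
  by (rule subsetD[OF rtrancl_mono]) (auto simp: edge_rel_def)

lemma edge_rel_rtrancl_sym: "(u, v) \<in> (edge_rel E)\<^sup>* \<Longrightarrow> (v, u) \<in> (edge_rel E)\<^sup>*"
  by (rule symD[OF sym_rtrancl]) (auto simp: sym_def insert_commute)

text \<open>Assign to every vertex but the root the last edge of a shortest walk from the root to it.\<close>

lemma card_le_Suc_card_edges:
  assumes "finite E" and conn: "\<And>v. v \<in> V \<Longrightarrow> (r, v) \<in> (edge_rel E)\<^sup>*" and "finite V"
  shows "card V \<le> Suc (card E)"
proof -
  define lev where "lev v = (LEAST m. (r, v) \<in> edge_rel E ^^ m)" for v
  have lev: "(r, v) \<in> edge_rel E ^^ lev v" if "(r, v) \<in> (edge_rel E)\<^sup>*" for v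
    using that unfolding lev_def rtrancl_power by (rule LeastI_ex)
  have lev_le: "lev v \<le> m" if "(r, v) \<in> edge_rel E ^^ m" for v m
    using that unfolding lev_def by (rule Least_le)
  have "\<exists>w. {w, v} \<in> E \<and> lev v = Suc (lev w)" if v: "v \<in> V - {r}" for v
  proof -
    have lv: "(r, v) \<in> edge_rel E ^^ lev v"
      using v conn lev by blast
    then obtain m where m: "lev v = Suc m"
      using v by (cases "lev v") auto
    then obtain w where w: "(r, w) \<in> edge_rel E ^^ m" "(w, v) \<in> edge_rel E"
      using lv by auto
    have "(r, v) \<in> edge_rel E ^^ Suc (lev w)"
      using w lev[of w] by (auto simp: rtrancl_power intro!: relcompI)
    then have "lev v = Suc (lev w)"
      using lev_le[OF w(1)] lev_le[of v "Suc (lev w)"] m by simp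
    with w show ?thesis by auto
  qed
  then obtain par where par: "\<And>v. v \<in> V - {r} \<Longrightarrow> {par v, v} \<in> E \<and> lev v = Suc (lev (par v))"
    by metis
  \<comment> \<open>If distinct vertices shared an edge, each would be the parent of the other, so
    each level would exceed the other.\<close>
  have "inj_on (\<lambda>v. {par v, v}) (V - {r})"
  proof (rule inj_onI)
    fix v w assume v: "v \<in> V - {r}" and w: "w \<in> V - {r}" and eq: "{par v, v} = {par w, w}"
    show "v = w"
    proof (rule ccontr)
      assume "v \<noteq> w"
      then have "par v = w" "par w = v"
        using eq by (auto simp: doubleton_eq_iff)
      then show False
        using par[OF v] par[OF w] by simp
    qed
  qed
  then have "card (V - {r}) \<le> card E"
    using par assms(1) by (intro card_inj_on_le) auto
  then show ?thesis
    using assms(3) by (cases "r \<in> V") (auto simp: card_Diff_singleton_if)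
qed

text \<open>On a forest every antisymmetric edge function is a gradient: a newly inserted edge joins
  two different components, and shifting the potential by a constant on one of them fits the new
  edge. Used contrapositively: a closed walk with nonzero total \<open>\<phi>\<close> forces a
  cycle.\<close>

lemma forest_potential:
  fixes \<phi> :: "'a \<Rightarrow> 'a \<Rightarrow> real"
  assumes "finite H" and "\<And>e. e \<in> H \<Longrightarrow> \<exists>a b. e = {a, b}"
    and anti: "\<And>a b. \<phi> b a = - \<phi> a b"
    and "\<And>a b. {a, b} \<in> H \<Longrightarrow> (a, b) \<notin> (edge_rel (H - {{a, b}}))\<^sup>*"
  shows "\<exists>\<psi>. \<forall>a b. {a, b} \<in> H \<longrightarrow> \<psi> b - \<psi> a = \<phi> a b"
  using assms(1,2,4)
proof (induction H)
  case empty
  then show ?case by simp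
next
  case (insert e H)
  have "(a, b) \<notin> (edge_rel (H - {{a, b}}))\<^sup>*" if "{a, b} \<in> H" for a b
    using insert.prems(2)[of a b] that edge_rel_rtrancl_mono[of "H - {{a, b}}" "insert e H - {{a, b}}" a b]
    by auto
  then obtain \<psi> where \<psi>: "\<And>a b. {a, b} \<in> H \<Longrightarrow> \<psi> b - \<psi> a = \<phi> a b"
    using insert.IH insert.prems(1) by (metis insertI2)
  obtain a b where e: "e = {a, b}"
    using insert.prems(1) by blast
  have ab: "(a, b) \<notin> (edge_rel H)\<^sup>*"
    using insert.prems(2)[of a b] insert.hyps(2) e by auto
  \<comment> \<open>The component of \<open>b\<close> before \<open>e\<close> is added. No edge of
    \<open>H\<close> leaves it, so a constant shift on it preserves all old differences.\<close>
  define R where "R = {v. (v, b) \<in> (edge_rel H)\<^sup>*}"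
  define \<psi>' where "\<psi>' v = \<psi> v + (if v \<in> R then \<phi> a b - \<psi> b + \<psi> a else 0)" for v
  have R: "u \<in> R \<longleftrightarrow> v \<in> R" if "{u, v} \<in> H" for u v
  proof -
    have "(u, v) \<in> edge_rel H" "(v, u) \<in> edge_rel H"
      using that by (auto simp: insert_commute)
    then show ?thesis
      unfolding R_def by (auto intro: converse_rtrancl_into_rtrancl)
  qed
  have "a \<notin> R" "b \<in> R"
    using ab by (auto simp: R_def)
  then have 1: "\<psi>' b - \<psi>' a = \<phi> a b"
    by (simp add: \<psi>'_def)
  have "\<psi>' v - \<psi>' u = \<phi> u v" if "{u, v} \<in> insert e H" for u v
  proof (cases "{u, v} \<in> H")
    case True
    then show ?thesis
      using R[OF True] \<psi>[OF True] by (simp add: \<psi>'_def)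
  next
    case False
    then have "u = a \<and> v = b \<or> u = b \<and> v = a"
      using that e by (auto simp: doubleton_eq_iff)
    then show ?thesis
      using 1 anti[of a b] by auto
  qed
  then show ?case by blast
qed

text \<open>Delete one cycle edge from each \<open>H j\<close>. Its detour stays in
  \<open>H j\<close>, which by disjointness contains no other deleted edge, so connectivity survives
  and the tree bound applies to what remains.\<close>

lemma card_edges_ge_disjoint_cycles:
  assumes "finite E" "finite V" "finite J"
    and conn: "\<And>u v. u \<in> V \<Longrightarrow> v \<in> V \<Longrightarrow> (u, v) \<in> (edge_rel E)\<^sup>*"
    and cyc: "\<And>j. j \<in> J \<Longrightarrow> \<exists>a b. {a, b} \<in> H j \<and> (a, b) \<in> (edge_rel (H j - {{a, b}}))\<^sup>*"
    and sub: "\<And>j. j \<in> J \<Longrightarrow> H j \<subseteq> E"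
    and disj: "\<And>i j. i \<in> J \<Longrightarrow> j \<in> J \<Longrightarrow> i \<noteq> j \<Longrightarrow> H i \<inter> H j = {}"
  shows "card V + card J \<le> Suc (card E)"
proof -
  obtain a b where ab: "\<And>j. j \<in> J \<Longrightarrow> {a j, b j} \<in> H j"
    "\<And>j. j \<in> J \<Longrightarrow> (a j, b j) \<in> (edge_rel (H j - {{a j, b j}}))\<^sup>*"
    using cyc by metis
  define F where "F = (\<lambda>j. {a j, b j}) ` J"
  have inj: "inj_on (\<lambda>j. {a j, b j}) J"
    using ab(1) disj by (intro inj_onI) (metis disjoint_iff)
  have FE: "F \<subseteq> E"
    using ab(1) sub by (auto simp: F_def)
  have detour: "(a j, b j) \<in> (edge_rel (E - F))\<^sup>*" if j: "j \<in> J" for j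
  proof (rule edge_rel_rtrancl_mono[OF _ ab(2)[OF j]])
    show "H j - {{a j, b j}} \<subseteq> E - F"
      using sub[OF j] disj[OF j] ab(1) by (auto simp: F_def)
  qed
  have "edge_rel E \<subseteq> (edge_rel (E - F))\<^sup>*"
  proof (rule subrelI)
    fix u v assume uv: "(u, v) \<in> edge_rel E"
    show "(u, v) \<in> (edge_rel (E - F))\<^sup>*"
    proof (cases "{u, v} \<in> F")
      case False
      then show ?thesis using uv by auto
    next
      case True
      then obtain j where "j \<in> J" "{u, v} = {a j, b j}"
        by (auto simp: F_def)
      then show ?thesis
        using detour[of j] edge_rel_rtrancl_sym[of "a j" "b j"] by (auto simp: doubleton_eq_iff)
    qed
  qed
  then have sub': "(edge_rel E)\<^sup>* \<subseteq> (edge_rel (E - F))\<^sup>*"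
    by (rule rtrancl_subset_rtrancl)
  have le: "card V \<le> Suc (card (E - F))"
  proof (cases "V = {}")
    case False
    then obtain r where "r \<in> V" by blast
    then show ?thesis
      using assms(1,2) conn sub' by (intro card_le_Suc_card_edges[of _ _ r]) auto
  qed auto
  have "card F = card J"
    unfolding F_def by (rule card_image[OF inj])
  moreover have "card (E - F) = card E - card F" "card F \<le> card E"
    using FE assms(1) by (auto intro: card_Diff_subset card_mono finite_subset)
  ultimately show ?thesis
    using le by simp
qed

subsection \<open>Walks and dilation\<close>

lemma walk_invariant:
  assumes "is_walk E p u v"
    and "\<And>i. Suc i < length p \<Longrightarrow> {p ! i, p ! Suc i} \<in> E \<Longrightarrow> f (p ! i) = f (p ! Suc i)"
  shows "f u = f v"
proof -
  have "i < length p \<Longrightarrow> f (p ! i) = f u" for i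
    using assms by (induction i) (auto simp: is_walk_def hd_conv_nth)
  from this[of "length p - 1"] show ?thesis
    using assms(1) by (auto simp: is_walk_def last_conv_nth)
qed

lemma walk_reachable:
  assumes "is_walk E p u v"
  shows "(u, v) \<in> (edge_rel E)\<^sup>*"
proof -
  have "i < length p \<Longrightarrow> (u, p ! i) \<in> (edge_rel E)\<^sup>*" for i
  proof (induction i)
    case (Suc i)
    then have "(p ! i, p ! Suc i) \<in> edge_rel E"
      using assms by (auto simp: is_walk_def)
    then show ?case
      using Suc by (auto intro: rtrancl_into_rtrancl)
  qed (use assms in \<open>auto simp: is_walk_def hd_conv_nth\<close>)
  from this[of "length p - 1"] show ?thesis
    using assms by (auto simp: is_walk_def last_conv_nth)
qed

lemma walk_vertices:
  assumes "is_walk E p u v" "geom_graph S E" "u \<in> S" "i < length p"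
  shows "p ! i \<in> S"
proof (cases i)
  case 0
  then show ?thesis using assms by (auto simp: is_walk_def hd_conv_nth)
next
  case (Suc j)
  then have "{p ! j, p ! i} \<in> E"
    using assms by (auto simp: is_walk_def)
  then show ?thesis
    using assms(2) by (fastforce simp: geom_graph_def doubleton_eq_iff)
qed

text \<open>By the triangle inequality along a prefix. This confines a short walk to a ball around
  its start.\<close>

lemma walk_dist_le:
  assumes "is_walk E p u v" "i < length p"
  shows "dist u (p ! i) \<le> walk_length p"
proof -
  have "dist u (p ! i) \<le> (\<Sum>j<i. dist (p ! j) (p ! Suc j))"
    using assms(2)
  proof (induction i)
    case 0
    then show ?case using assms by (auto simp: is_walk_def hd_conv_nth)
  next
    case (Suc i)
    then show ?case
      using dist_triangle[of u "p ! Suc i" "p ! i"] by simp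
  qed
  also have "\<dots> \<le> walk_length p"
    unfolding walk_length_def using assms(2) by (intro sum_mono2) auto
  finally show ?thesis .
qed

lemma dist_le_walk_length:
  assumes "is_walk E p u v"
  shows "dist u v \<le> walk_length p"
  using walk_dist_le[OF assms, of "length p - 1"] assms
  by (auto simp: is_walk_def last_conv_nth)

text \<open>A strict upper bound on an infimum is witnessed by an actual walk, so no shortest path
  has to be shown to exist.\<close>

lemma dilation_less_imp_walk:
  assumes "dilation V E < ereal D" "u \<in> V" "v \<in> V" "u \<noteq> v"
  obtains p where "is_walk E p u v" "walk_length p < D * dist u v"
proof -
  have "graph_dist E u v / ereal (dist u v) \<le> dilation V E"
    unfolding dilation_def using assms(2-4) by (intro SUP_upper2[of "(u, v)"]) auto
  then have "graph_dist E u v / ereal (dist u v) < ereal D"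
    using assms(1) by (rule le_less_trans)
  then have "graph_dist E u v < ereal (D * dist u v)"
    using assms(4) by (cases "graph_dist E u v") (auto simp: divide_simps)
  then show thesis
    using that unfolding graph_dist_def INF_less_iff by auto
qed

lemma dilation_ge_1:
  assumes "u \<in> V" "v \<in> V" "u \<noteq> v"
  shows "1 \<le> dilation V E"
proof (rule ccontr)
  assume "\<not> 1 \<le> dilation V E"
  then have "dilation V E < ereal 1"
    by (simp add: one_ereal_def)
  from dilation_less_imp_walk[OF this assms] dist_le_walk_length show False
    by (metis mult_1 not_le)
qed

subsection \<open>Points on two horizontal lines\<close>

definition two_lines :: "point set" where
  "two_lines = {p. p $ 2 = 0 \<or> p $ 2 = 1}"

definition pt :: "real \<Rightarrow> real \<Rightarrow> point" where
  "pt x y = vector [x, y]"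

lemma pt_nth [simp]: "pt x y $ 1 = x" "pt x y $ 2 = y"
  by (simp_all add: pt_def)

lemma dist_pt_horizontal [simp]: "dist (pt x y) (pt x' y) = \<bar>x - x'\<bar>"
  by (simp add: dist_vec_def L2_set_def sum_2 dist_real_def)

lemma dist_pt_vertical [simp]: "dist (pt x y) (pt x y') = \<bar>y - y'\<bar>"
  by (simp add: dist_vec_def L2_set_def sum_2 dist_real_def)

text \<open>The hull lies in the strip between heights 0 and 1, and no point of the two lines is
  interior to that strip. Collinear points are allowed by this notion of convex position.\<close>

lemma convex_position_two_lines:
  assumes "S \<subseteq> two_lines"
  shows "convex_position S"
  unfolding convex_position_def
proof
  fix p assume p: "p \<in> S"
  let ?e = "axis 2 1 :: point"
  have lo: "convex hull S \<subseteq> {q. ?e \<bullet> q \<ge> 0}"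
    using assms by (intro hull_minimal convex_halfspace_ge) (auto simp: two_lines_def inner_axis')
  have hi: "convex hull S \<subseteq> {q. ?e \<bullet> q \<le> 1}"
    using assms by (intro hull_minimal convex_halfspace_le) (auto simp: two_lines_def inner_axis')
  have ne: "?e \<noteq> 0"
    by (simp add: axis_eq_0_iff)
  have "p \<notin> interior (convex hull S)"
  proof
    assume "p \<in> interior (convex hull S)"
    then have "p \<in> interior {q. ?e \<bullet> q \<ge> 0}" "p \<in> interior {q. ?e \<bullet> q \<le> 1}"
      using interior_mono[OF lo] interior_mono[OF hi] by auto
    then have "?e \<bullet> p > 0" "?e \<bullet> p < 1"
      using ne by (auto simp: interior_halfspace_ge interior_halfspace_le)
    then show False
      using p assms by (auto simp: two_lines_def inner_axis')
  qed
  moreover have "p \<in> closure (convex hull S)"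
    using p by (meson closure_subset hull_inc subsetD)
  ultimately show "p \<in> frontier (convex hull S)"
    by (simp add: frontier_def)
qed

text \<open>Pads the gadgets to exactly \<open>n\<close> points. The gadget argument tolerates
  arbitrary further points on the two lines.\<close>

lemma extend_in_two_lines:
  assumes "finite B" "B \<subseteq> two_lines" "card B \<le> n"
  obtains S where "finite S" "card S = n" "B \<subseteq> S" "S \<subseteq> two_lines"
proof -
  have "inj (\<lambda>x. pt x 0)"
    by (metis injI pt_nth(1))
  then have "infinite (range (\<lambda>x. pt x 0))"
    using infinite_UNIV_char_0 finite_imageD by blast
  then have "infinite (two_lines - B)"
    using assms(1) by (metis (mono_tags, lifting) Diff_infinite_finite UNIV_I finite_subset image_subsetI
        mem_Collect_eq pt_nth(2) two_lines_def)
  then obtain C where "finite C" "card C = n - card B" "C \<subseteq> two_lines - B"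
    by (meson infinite_arbitrarily_large)
  moreover from this have "card (B \<union> C) = n"
    using assms by (subst card_Un_disjoint) auto
  ultimately have "finite (B \<union> C)" "card (B \<union> C) = n" "B \<subseteq> B \<union> C" "B \<union> C \<subseteq> two_lines"
    using assms by auto
  then show thesis by (rule that)
qed

lemma delta_C_ge_min_dilation:
  assumes "finite S" "card S = n" "S \<subseteq> two_lines"
  shows "min_dilation S k \<le> delta_C n k"
  unfolding delta_C_def using assms by (intro SUP_upper) (auto intro: convex_position_two_lines)

subsection \<open>One gadget\<close>

text \<open>The half-width \<open>2 * X + 1\<close> exceeds the reach of every walk used: these
  start within \<open>X\<close> of \<open>c\<close> and are shorter than \<open>X\<close> or
  \<open>(1 + X) / 2\<close>. Centres \<open>4 * X + 2\<close> apart therefore get disjoint edge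
  sets.\<close>

definition gadget_edges :: "point set set \<Rightarrow> real \<Rightarrow> real \<Rightarrow> point set set" where
  "gadget_edges E c X = {e \<in> E. \<forall>w\<in>e. \<bar>w $ 1 - c\<bar> < 2 * X + 1}"

text \<open>No cycle is exhibited. If \<open>H\<close> were a forest, the signed count of crossings
  of \<open>c\<close> on the upper line would have a potential \<open>\<psi>\<close>, and following
  \<open>\<psi>\<close> once around the gadget gives \<open>1 = 0\<close>.\<close>

lemma gadget_contains_cycle:
  fixes c D \<epsilon> :: real and N :: nat and E :: "point set set"
  defines "f \<equiv> \<lambda>i. (1 + \<epsilon>) ^ i - 1"
  defines "H \<equiv> gadget_edges E c (f N)"
  assumes E: "geom_graph S E" "finite E" and S: "S \<subseteq> two_lines"
    and walk: "\<And>u v. u \<in> S \<Longrightarrow> v \<in> S \<Longrightarrow> u \<noteq> v \<Longrightarrow> \<exists>p. is_walk E p u v \<and> walk_length p < D * dist u v"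
    and mem: "\<And>i s y. i \<le> N \<Longrightarrow> s \<in> {1, -1} \<Longrightarrow> y \<in> {0, 1} \<Longrightarrow> pt (c + s * f i) y \<in> S"
    and par: "\<epsilon> > 0" "D > 0" "D * \<epsilon> \<le> 1/2" "D \<le> f N"
  shows "\<exists>a b. {a, b} \<in> H \<and> (a, b) \<in> (edge_rel (H - {{a, b}}))\<^sup>*"
proof (rule ccontr)
  assume no_cycle: "\<not> ?thesis"
  define side where "side v = (if (v :: point) $ 1 \<ge> c then 1 else 0 :: real)" for v
  \<comment> \<open>Signed crossing of the abscissa \<open>c\<close>, counted only for edges with
    both ends on the upper line.\<close>
  define \<phi> where "\<phi> u v = (if u $ 2 = 1 \<and> v $ 2 = 1 then side v - side u else 0)" for u v
  have "\<exists>\<psi>. \<forall>a b. {a, b} \<in> H \<longrightarrow> \<psi> b - \<psi> a = \<phi> a b"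
  proof (rule forest_potential)
    show "\<exists>a b. e = {a, b}" if "e \<in> H" for e
      using that E(1) unfolding H_def gadget_edges_def geom_graph_def by blast
    show "finite H"
      using E(2) by (simp add: H_def gadget_edges_def)
    show "\<phi> b a = - \<phi> a b" for a b
      by (simp add: \<phi>_def)
    show "(a, b) \<notin> (edge_rel (H - {{a, b}}))\<^sup>*" if "{a, b} \<in> H" for a b
      using no_cycle that by blast
  qed
  then obtain \<psi> where \<psi>: "\<And>a b. {a, b} \<in> H \<Longrightarrow> \<psi> b - \<psi> a = \<phi> a b"
    by blast

  have f_mono: "f i \<le> f j" if "i \<le> j" for i j
    using that par(1) by (simp add: f_def power_increasing)
  have f_0: "f 0 = 0"
    by (simp add: f_def)
  have f_nonneg: "f i \<ge> 0" for i
    using f_mono[of 0 i] f_0 by simp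
  have f_Suc: "f (Suc i) = f i + \<epsilon> * (1 + f i)" for i
    by (simp add: f_def algebra_simps)

  have close: "\<bar>w $ 1 - u $ 1\<bar> < l" "\<bar>w $ 2 - u $ 2\<bar> < l" "w \<in> S"
    if w: "is_walk E p u v" "walk_length p < l" "u \<in> S" "w \<in> set p" for p u v w l
  proof -
    obtain i where i: "i < length p" "w = p ! i"
      using w(4) by (auto simp: in_set_conv_nth)
    have "dist u w < l"
      using walk_dist_le[OF w(1) i(1)] i w(2) by simp
    then have "dist (u $ j) (w $ j) < l" for j
      using dist_vec_nth_le[of u j w] by simp
    then show "\<bar>w $ 1 - u $ 1\<bar> < l" "\<bar>w $ 2 - u $ 2\<bar> < l"
      by (simp_all add: dist_real_def abs_minus_commute)
    show "w \<in> S"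
      using walk_vertices[OF w(1) E(1) w(3) i(1)] i by simp
  qed

  \<comment> \<open>A walk that stays on one line may cross \<open>c\<close>: on the upper line
    \<open>\<psi>\<close> then changes exactly with \<open>side\<close>, on the lower line not at
    all.\<close>
  have row: "\<psi> u - (if y = 1 then side u else 0) = \<psi> v - (if y = 1 then side v else 0)"
    if "is_walk E p u v" "\<And>w. w \<in> set p \<Longrightarrow> w $ 2 = y \<and> \<bar>w $ 1 - c\<bar> < 2 * f N + 1" for p u v y
    using that(1)
  proof (rule walk_invariant)
    fix i assume i: "Suc i < length p" "{p ! i, p ! Suc i} \<in> E"
    then have mem: "p ! i \<in> set p" "p ! Suc i \<in> set p"
      by auto
    then have "{p ! i, p ! Suc i} \<in> H"
      using i that(2) by (auto simp: H_def gadget_edges_def)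
    from \<psi>[OF this] show "\<psi> (p ! i) - (if y = 1 then side (p ! i) else 0)
        = \<psi> (p ! Suc i) - (if y = 1 then side (p ! Suc i) else 0)"
      using that(2)[OF mem(1)] that(2)[OF mem(2)] by (auto simp: \<phi>_def)
  qed
  \<comment> \<open>A walk that stays on one side may change lines, as \<open>\<phi>\<close>
    vanishes on each of its edges.\<close>
  have sided: "\<psi> u = \<psi> v"
    if "is_walk E p u v" "\<And>w. w \<in> set p \<Longrightarrow> side w = z \<and> \<bar>w $ 1 - c\<bar> < 2 * f N + 1" for p u v z
    using that(1)
  proof (rule walk_invariant)
    fix i assume i: "Suc i < length p" "{p ! i, p ! Suc i} \<in> E"
    then have mem: "p ! i \<in> set p" "p ! Suc i \<in> set p"
      by auto
    then have "{p ! i, p ! Suc i} \<in> H"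
      using i that(2) by (auto simp: H_def gadget_edges_def)
    from \<psi>[OF this] show "\<psi> (p ! i) = \<psi> (p ! Suc i)"
      using that(2)[OF mem(1)] that(2)[OF mem(2)] by (auto simp: \<phi>_def split: if_splits)
  qed

  define P where "P s i y = pt (c + s * f i) y" for s i y
  define \<psi>' where "\<psi>' y v = \<psi> v - (if y = (1::real) then side v else 0)" for y v
  \<comment> \<open>The strict bound matters for \<open>s = -1\<close>, because the abscissa
    \<open>c\<close> itself counts as the right side.\<close>
  have side_P: "side w = side (P s i y)"
    if "s \<in> {1, -1}" "\<bar>w $ 1 - P s i y $ 1\<bar> < f i" for s i y and w :: point
    using that f_nonneg[of i] by (auto simp: side_def P_def)
  have step: "\<psi>' y (P s i y) = \<psi>' y (P s (Suc i) y)"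
    if i: "Suc i \<le> N" and s: "s \<in> {1, -1}" and y: "y \<in> {0, 1}" for i s y
  proof -
    let ?u = "P s i y" and ?v = "P s (Suc i) y"
    have S: "?u \<in> S" "?v \<in> S"
      using mem i s y by (auto simp: P_def)
    have pos: "\<epsilon> * (1 + f i) > 0"
      using f_nonneg[of i] par(1) by simp
    have "dist ?u ?v = \<bar>f (Suc i) - f i\<bar>"
      using s by (auto simp: P_def)
    also have "\<dots> = \<epsilon> * (1 + f i)"
      using f_Suc[of i] pos by linarith
    finally have d: "dist ?u ?v = \<epsilon> * (1 + f i)" .
    with pos have "?u \<noteq> ?v"
      by auto
    then obtain p where p: "is_walk E p ?u ?v" "walk_length p < D * dist ?u ?v"
      using walk S by blast
    have "D * dist ?u ?v = D * \<epsilon> * (1 + f i)"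
      by (simp add: d)
    also have "\<dots> \<le> 1/2 * (1 + f i)"
      using par(3) f_nonneg[of i] by (intro mult_right_mono) auto
    finally have p': "walk_length p < (1 + f i) / 2"
      using p(2) by simp
    have u1: "\<bar>?u $ 1 - c\<bar> = f i" "f i \<le> f N"
      using s f_nonneg[of i] f_mono[of i N] i by (auto simp: P_def)
    have region: "\<bar>w $ 1 - c\<bar> < 2 * f N + 1" if "w \<in> set p" for w
    proof -
      have "\<bar>w $ 1 - c\<bar> \<le> \<bar>w $ 1 - ?u $ 1\<bar> + \<bar>?u $ 1 - c\<bar>"
        by linarith
      also have "\<dots> < (1 + f i) / 2 + f i"
        using close(1)[OF p(1) p' S(1) that] u1(1) by linarith
      also have "\<dots> \<le> 2 * f N + 1"
        using u1(2) f_nonneg[of N] by (simp add: field_simps)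
      finally show ?thesis .
    qed
    show ?thesis
    \<comment> \<open>The walk is shorter than \<open>(1 + f i) / 2\<close>. This is at most 1, the
      gap between the lines, if \<open>f i \<le> 1\<close>; otherwise it is less than
      \<open>f i\<close>, the distance to the abscissa \<open>c\<close>.\<close>
    proof (cases "f i \<le> 1")
      case True
      have "w $ 2 = y" if "w \<in> set p" for w
        using close(2,3)[OF p(1) p' S(1) that] True y assms(5) by (auto simp: two_lines_def P_def)
      then show ?thesis
        unfolding \<psi>'_def using row[OF p(1)] region by blast
    next
      case False
      have "side w = side ?u" if "w \<in> set p" for w
        using close(1)[OF p(1) p' S(1) that] False s by (intro side_P) auto
      then have "\<psi> ?u = \<psi> ?v"
        using sided[OF p(1)] region by blast
      moreover have "side ?u = side ?v"
        using False s par(1) f_nonneg[of "Suc i"] f_mono[of i "Suc i"] by (auto simp: side_def P_def)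
      ultimately show ?thesis
        unfolding \<psi>'_def by (simp only:)
    qed
  qed
  have chain: "\<psi>' y (P s N y) = \<psi>' y (P s 0 y)" if "s \<in> {1, -1}" "y \<in> {0, 1}" for s y
  proof -
    have "i \<le> N \<Longrightarrow> \<psi>' y (P s i y) = \<psi>' y (P s 0 y)" for i
    proof (induction i)
      case (Suc i)
      then show ?case
        using step[OF Suc.prems that] by simp
    qed simp
    then show ?thesis by blast
  qed
  \<comment> \<open>The two arms meet at the centre: since \<open>f 0 = 0\<close>, both signs give
    the same point for index 0.\<close>
  have line: "\<psi>' y (P 1 N y) = \<psi>' y (P (-1) N y)" if "y \<in> {0, 1}" for y
    using chain[of 1 y] chain[of "-1" y] that f_0 by (simp add: P_def)
  \<comment> \<open>The end points are at distance 1, so the walk is shorter than \<open>D\<close>,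
    hence than \<open>f N\<close>, and cannot reach the abscissa \<open>c\<close>.\<close>
  have link: "\<psi> (P s N 0) = \<psi> (P s N 1)" if s: "s \<in> {1, -1}" for s
  proof -
    let ?u = "P s N 0" and ?v = "P s N 1"
    have S: "?u \<in> S" "?v \<in> S"
      using mem s by (auto simp: P_def)
    have d: "dist ?u ?v = 1"
      by (simp add: P_def)
    then have "?u \<noteq> ?v"
      by auto
    then obtain p where p: "is_walk E p ?u ?v" "walk_length p < D * dist ?u ?v"
      using walk S by blast
    then have p': "walk_length p < f N"
      using d par(4) by simp
    have "\<bar>?u $ 1 - c\<bar> = f N"
      using s f_nonneg[of N] by (auto simp: P_def)
    then have "side w = side ?u \<and> \<bar>w $ 1 - c\<bar> < 2 * f N + 1" if "w \<in> set p" for w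
      using close(1)[OF p(1) p' S(1) that] s side_P[of s w N 0] by auto
    then show ?thesis
      using sided[OF p(1)] by blast
  qed
  have "side (P 1 N 1) = 1" "side (P (-1) N 1) = 0"
    using par(2,4) by (auto simp: side_def P_def)
  then show False
    using line[of 0] line[of 1] link[of 1] link[of "-1"] by (simp add: \<psi>'_def)
qed

subsection \<open>The lower bound\<close>

text \<open>The \<open>k + 1\<close> gadgets force at least \<open>card S + k\<close> edges on any
  graph of dilation below \<open>D\<close>, one more than the graph has.\<close>

lemma gadgets_min_dilation_ge:
  fixes D \<epsilon> :: real and N k :: nat
  defines "f \<equiv> \<lambda>i. (1 + \<epsilon>) ^ i - 1"
  assumes S: "finite S" "S \<subseteq> two_lines" "S \<noteq> {}"
    and mem: "\<And>i j s y. j \<le> k \<Longrightarrow> i \<le> N \<Longrightarrow> s \<in> {1, -1} \<Longrightarrow> y \<in> {0, 1} \<Longrightarrow>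
      pt (real j * (4 * f N + 2) + s * f i) y \<in> S"
    and par: "\<epsilon> > 0" "D > 0" "D * \<epsilon> \<le> 1/2" "D \<le> f N"
  shows "ereal D \<le> min_dilation S k"
  unfolding min_dilation_def
proof (rule INF_greatest, rule ccontr)
  fix E assume "E \<in> {E. geom_graph S E \<and> card E = card S - 1 + k}"
  then have E: "geom_graph S E" "card E = card S - 1 + k"
    by auto
  assume "\<not> ereal D \<le> dilation S E"
  then have dil: "dilation S E < ereal D"
    by simp
  have "E \<subseteq> Pow S"
    using E(1) by (auto simp: geom_graph_def)
  then have fin: "finite E"
    using S(1) by (simp add: finite_subset)
  have walk: "\<exists>p. is_walk E p u v \<and> walk_length p < D * dist u v" if "u \<in> S" "v \<in> S" "u \<noteq> v" for u v
    using dilation_less_imp_walk[OF dil that] by blast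
  define c where "c j = real j * (4 * f N + 2)" for j :: nat
  define H where "H j = gadget_edges E (c j) (f N)" for j
  have "card S + card {..k} \<le> Suc (card E)"
  proof (rule card_edges_ge_disjoint_cycles[of E S "{..k}" H])
    show "(u, v) \<in> (edge_rel E)\<^sup>*" if "u \<in> S" "v \<in> S" for u v
      using walk[OF that] walk_reachable by (cases "u = v") auto
    show "\<exists>a b. {a, b} \<in> H j \<and> (a, b) \<in> (edge_rel (H j - {{a, b}}))\<^sup>*" if "j \<in> {..k}" for j
      unfolding H_def f_def using that mem par
      by (intro gadget_contains_cycle[OF E(1) fin S(2) walk]) (auto simp: f_def c_def)
    show "H j \<subseteq> E" for j
      by (auto simp: H_def gadget_edges_def)
    fix i j :: nat assume ij: "i \<in> {..k}" "j \<in> {..k}" "i \<noteq> j"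
    show "H i \<inter> H j = {}"
    proof (rule ccontr)
      assume "H i \<inter> H j \<noteq> {}"
      then obtain e where e: "e \<in> H i" "e \<in> H j"
        by blast
      then obtain w where "w \<in> e"
        using E(1) unfolding H_def gadget_edges_def geom_graph_def by blast
      then have "\<bar>w $ 1 - c i\<bar> < 2 * f N + 1" "\<bar>w $ 1 - c j\<bar> < 2 * f N + 1"
        using e by (auto simp: H_def gadget_edges_def)
      then have "\<bar>c i - c j\<bar> < 4 * f N + 2"
        by linarith
      moreover have "\<bar>c i - c j\<bar> = \<bar>real i - real j\<bar> * (4 * f N + 2)"
        using par by (simp add: c_def abs_mult flip: left_diff_distrib)
      moreover have "\<bar>real i - real j\<bar> \<ge> 1"
        using ij(3) by linarith
      then have "\<bar>real i - real j\<bar> * (4 * f N + 2) \<ge> 1 * (4 * f N + 2)"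
        using par by (intro mult_right_mono) auto
      ultimately show False by simp
    qed
  qed (use fin S in auto)
  \<comment> \<open>Needed because \<open>card S - 1\<close> is a truncated subtraction.\<close>
  moreover have "card S > 0"
    using S by (simp add: card_gt_0_iff)
  ultimately show False
    using E(2) by simp
qed

text \<open>Covers the range of \<open>k\<close> where the claimed bound falls below 1.\<close>

lemma delta_C_ge_1:
  assumes "n \<ge> 2"
  shows "1 \<le> delta_C n k"
proof -
  obtain S where S: "finite S" "card S = n" "S \<subseteq> two_lines"
    using extend_in_two_lines[of "{}" n] by auto
  then obtain u v where "u \<in> S" "v \<in> S" "u \<noteq> v"
    using assms by (metis One_nat_def card_le_Suc0_iff_eq not_less_eq_eq numeral_2_eq_2)
  then have "1 \<le> min_dilation S k"
    unfolding min_dilation_def by (intro INF_greatest dilation_ge_1)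
  then show ?thesis
    using delta_C_ge_min_dilation[OF S] order_trans by blast
qed

text \<open>The choice \<open>1 / (2 * D)\<close> for \<open>\<epsilon>\<close> makes
  \<open>D * \<epsilon>\<close> equal to 1/2, and \<open>X\<close> says that the gadget extends to
  \<open>D\<close> or beyond. A gadget has at most \<open>4 * N + 4\<close> points, which is at most
  \<open>8 * N\<close>.\<close>

lemma delta_C_ge:
  fixes n N k :: nat and D :: real
  assumes "8 * N * (k + 1) \<le> n" "N \<ge> 1" "D > 0" and X: "1 + D \<le> (1 + 1 / (2 * D)) ^ N"
  shows "ereal D \<le> delta_C n k"
proof -
  define f where "f i = (1 + 1 / (2 * D)) ^ i - 1" for i :: nat
  define B where "B = (\<lambda>(j, i, s, y). pt (real j * (4 * f N + 2) + s * f i) y) `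
    ({..k} \<times> {..N} \<times> {1, -1} \<times> {0, 1})"
  have "finite B"
    by (simp add: B_def)
  moreover have "B \<subseteq> two_lines"
    by (auto simp: B_def two_lines_def)
  moreover have "card B \<le> n"
  proof -
    have "card B \<le> card ({..k} \<times> {..N} \<times> {1, -1 :: real} \<times> {0, 1 :: real})"
      unfolding B_def by (intro card_image_le) auto
    also have "\<dots> = (k + 1) * (4 * N + 4)"
      by (simp add: card_cartesian_product algebra_simps)
    also have "\<dots> \<le> (k + 1) * (8 * N)"
      using assms(2) by (intro mult_left_mono) auto
    finally show ?thesis
      using assms(1) by (simp add: mult.commute)
  qed
  ultimately obtain S where S: "finite S" "card S = n" "B \<subseteq> S" "S \<subseteq> two_lines"
    by (rule extend_in_two_lines)
  have mem: "pt (real j * (4 * f N + 2) + s * f i) y \<in> S"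
    if "j \<le> k" "i \<le> N" "s \<in> {1, -1}" "y \<in> {0, 1}" for i j s y
  proof -
    have "(\<lambda>(j, i, s, y). pt (real j * (4 * f N + 2) + s * f i) y) (j, i, s, y) \<in> B"
      unfolding B_def using that by (intro imageI) auto
    then show ?thesis
      using S(3) by auto
  qed
  have "ereal D \<le> min_dilation S k"
    using S mem assms(3) X mem[of 0 0 1 0]
    by (intro gadgets_min_dilation_ge[where \<epsilon> = "1 / (2 * D)" and N = N]) (auto simp: f_def)
  then show ?thesis
    using delta_C_ge_min_dilation[OF S(1,2,4)] order_trans by blast
qed

theorem theorem3:
  shows "\<exists>c::real. c > 0 \<and> (\<exists>n0::nat. \<forall>n k. n \<ge> n0 \<longrightarrow> k < n \<longrightarrow>
           delta_C n k \<ge> ereal (c * real n / ((real k + 1) * ln (real n))))"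
proof -
  have "ereal (1/64 * real n / ((real k + 1) * ln (real n))) \<le> delta_C n k" if n: "n \<ge> 3" for n k
  proof -
    \<comment> \<open>The 64 is 16 times 4: \<open>N\<close> will be at least
      \<open>n / (16 * (k + 1))\<close> after rounding, and the growth estimate needs
      \<open>N\<close> to be at least \<open>4 * D * ln n\<close>.\<close>
    define D where "D = 1/64 * real n / ((real k + 1) * ln (real n))"
    show ?thesis
    proof (cases "D \<ge> 1")
      case False
      then have "ereal D \<le> 1"
        by (simp add: one_ereal_def)
      then show ?thesis
        using order_trans[OF _ delta_C_ge_1[of n k]] n unfolding D_def by simp
    next
      case True
      have ln: "ln (real n) \<ge> 1"
        using n exp_le by (subst ln_ge_iff) auto
      define N where "N = n div (8 * (k + 1))"
      have kl: "(real k + 1) * ln (real n) \<ge> real k + 1"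
        using mult_left_mono[OF ln, of "real k + 1"] by simp
      have nD: "real n = 64 * D * ((real k + 1) * ln (real n))"
        using ln by (simp add: D_def)
      have "64 * ((real k + 1) * ln (real n)) \<le> real n"
        using True kl by (subst (2) nD) (intro mult_right_mono, auto)
      moreover have "8 * (real k + 1) \<le> 64 * ((real k + 1) * ln (real n))"
        using kl by (intro mult_mono) auto
      ultimately have "real (8 * (k + 1)) \<le> real n"
        by simp
      then have le: "8 * (k + 1) \<le> n"
        by (simp only: of_nat_le_iff)
      then have N1: "N \<ge> 1"
        unfolding N_def by (simp add: Suc_le_eq div_greater_zero_iff)
      have Nn: "8 * N * (k + 1) \<le> n"
        using div_times_less_eq_dividend[of n "8 * (k + 1)"] by (simp add: N_def algebra_simps)
      \<comment> \<open>Rounding down in \<open>N\<close> costs at most a factor of 2, since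
        \<open>N \<ge> 1\<close>.\<close>
      have "n < 8 * (k + 1) * (N + 1)"
        unfolding N_def using dividend_less_div_times[of "8 * (k + 1)" n] by (simp add: algebra_simps)
      also have "\<dots> \<le> 8 * (k + 1) * (2 * N)"
        using N1 by (intro mult_left_mono) auto
      finally have "real n \<le> real (16 * N * (k + 1))"
        by (intro of_nat_mono) (simp add: algebra_simps)
      then have "64 * D * ln (real n) * (real k + 1) \<le> 16 * real N * (real k + 1)"
        by (subst (asm) nD) (simp add: algebra_simps)
      then have ND: "4 * D * ln (real n) \<le> real N"
        by simp
      define x where "x = 1 / (2 * D)"
      have x: "x > 0" "x \<le> 1/2"
        using True by (auto simp: x_def field_simps)
      have "D \<le> D * ((real k + 1) * ln (real n))"
        using True mult_left_mono[of 1 "(real k + 1) * ln (real n)" D] order_trans[OF _ kl, of 1] by simp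
      then have "1 + D \<le> real n"
        using True nD[unfolded mult.assoc] by linarith
      also have "\<dots> = exp (ln (real n))"
        using n by simp
      also have "\<dots> \<le> exp (real N * ln (1 + x))"
      proof -
        \<comment> \<open>Turns the bound \<open>ln (1 + x) \<ge> x - x\<^sup>2\<close> into the
          linear bound \<open>x / 2\<close>; this is where \<open>D \<ge> 1\<close> enters, through
          \<open>x \<le> 1/2\<close>.\<close>
        have "x\<^sup>2 \<le> x / 2"
          using x mult_left_mono[of x "1/2" x] by (simp add: power2_eq_square)
        then have "x / 2 \<le> ln (1 + x)"
          using ln_one_plus_pos_lower_bound[of x] x by simp
        then have "real N * (x / 2) \<le> real N * ln (1 + x)"
          by (intro mult_left_mono) auto
        moreover have "ln (real n) \<le> real N * (x / 2)"
          using ND True by (simp add: x_def field_simps)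
        ultimately show ?thesis by simp
      qed
      also have "\<dots> = (1 + x) ^ N"
        using x by (simp add: exp_of_nat_mult)
      finally have "1 + D \<le> (1 + 1 / (2 * D)) ^ N"
        by (simp add: x_def)
      then show ?thesis
        using delta_C_ge[OF Nn N1] True unfolding D_def[symmetric] by simp
    qed
  qed
  then show ?thesis
    by (intro exI[of _ "1/64"]) auto
qed

end
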